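(* For every integer $h\geq 1$, there is a planar poset $P$ of height $h$ with $\dim(P) \geq (4/3)h-2$.
   Context: All posets are finite. The height of a poset is the maximum size of a chain in it. The dimension $\dim(P)$ of a poset $P$ is the least integer $d$ such that $P$ is the intersection of $d$ linear orders. A cover relation of $P$ is a relation $a\leq b$ in $P$ with $a\neq b$ such that there is no element $c$ distinct from $a,b$ with $a\leq c\leq b$ in $P$. A diagram of $P$ is a drawing in the plane in which elements are distinct points and each cover relation $a\leq b$ is represented by a curve from $a$ to $b$ going upwards (i.e. strictly increasing in the $y$-coordinate). A poset is planar if it has a diagram drawn in a planar way (without crossings: curves meet only at common endpoints, and no curve passes through a point representing an element other than its endpoints). *)

theory Defs
  imports "HOL-Analysis.Analysis"
begin

(* A poset is a carrier A with a relation r satisfying partial_order_on A r;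
   (a, b) \<in> r is read a \<le> b.  partial_order_on A r includes r \<subseteq> A \<times> A, so that members
   of Chains r are automatically subsets of A. *)

definition poset_height :: "('a \<times> 'a) set \<Rightarrow> nat" where
  "poset_height r = Max (card ` Chains r)"

(* The family must be nonempty because \<Inter>{} = UNIV; hence chains have dimension 1.
   For a finite poset such a family exists (Szpilrajn), so the least number is attained. *)

definition poset_dim :: "'a set \<Rightarrow> ('a \<times> 'a) set \<Rightarrow> nat" where
  "poset_dim A r = (LEAST d. \<exists>L. finite L \<and> L \<noteq> {} \<and> card L = d \<and>
     (\<forall>l\<in>L. linear_order_on A l) \<and> r = \<Inter>L)"

definition cover_relations :: "('a \<times> 'a) set \<Rightarrow> ('a \<times> 'a) set" where
  "cover_relations r = {(a, b). (a, b) \<in> r \<and> a \<noteq> b \<and>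
     \<not> (\<exists>c. c \<noteq> a \<and> c \<noteq> b \<and> (a, c) \<in> r \<and> (c, b) \<in> r)}"

(* p places the elements in the plane; \<gamma> assigns to each cover relation a curve parametrised
   by the unit interval.  The second coordinate of the plane is the vertical one. *)

definition is_diagram ::
  "'a set \<Rightarrow> ('a \<times> 'a) set \<Rightarrow> ('a \<Rightarrow> real \<times> real) \<Rightarrow> ('a \<times> 'a \<Rightarrow> real \<Rightarrow> real \<times> real) \<Rightarrow> bool" where
  "is_diagram A r p \<gamma> \<longleftrightarrow> inj_on p A \<and>
     (\<forall>(a, b)\<in>cover_relations r.
        path (\<gamma> (a, b)) \<and> pathstart (\<gamma> (a, b)) = p a \<and> pathfinish (\<gamma> (a, b)) = p b \<and>
        strict_mono_on {0..1} (\<lambda>t. snd (\<gamma> (a, b) t)))"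

definition crossing_free ::
  "'a set \<Rightarrow> ('a \<times> 'a) set \<Rightarrow> ('a \<Rightarrow> real \<times> real) \<Rightarrow> ('a \<times> 'a \<Rightarrow> real \<Rightarrow> real \<times> real) \<Rightarrow> bool" where
  "crossing_free A r p \<gamma> \<longleftrightarrow>
     (\<forall>(a, b)\<in>cover_relations r. \<forall>c\<in>A. p c \<in> path_image (\<gamma> (a, b)) \<longrightarrow> c = a \<or> c = b) \<and>
     (\<forall>(a, b)\<in>cover_relations r. \<forall>(c, d)\<in>cover_relations r. (a, b) \<noteq> (c, d) \<longrightarrow>
        path_image (\<gamma> (a, b)) \<inter> path_image (\<gamma> (c, d)) \<subseteq> {p a, p b} \<inter> {p c, p d})"

definition planar_poset :: "'a set \<Rightarrow> ('a \<times> 'a) set \<Rightarrow> bool" where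
  "planar_poset A r \<longleftrightarrow> finite A \<and> partial_order_on A r \<and>
     (\<exists>p \<gamma>. is_diagram A r p \<gamma> \<and> crossing_free A r p \<gamma>)"

end

theory Submission
  imports Defs
begin

text \<open>
  The poset contains a standard example whose pairs are arranged in nested layers, two pairs per
  layer, as in a variant of Kelly's construction. A chain of nodes \<open>t\<^sub>0 < t\<^sub>1 < \<dots>\<close> runs outwards and
  a chain \<open>s\<^sub>0 > s\<^sub>1 > \<dots>\<close> runs inwards; \<open>a\<close> lies below every \<open>b\<close> of an outer layer through the first
  chain and below every \<open>b\<close> of an inner layer through the second. Inside a layer each \<open>a\<close> lies below
  the \<open>b\<close> of the other pair through an extra node \<open>w\<close>. These two nodes \<open>w\<close> are parallel and can both
  be inserted into the same chain, so a layer lengthens one chain by 1 and the other one by 2. If the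
  chains take turns, two layers cost 3 in height and gain 4 in dimension.

  A layer is drawn around the previous ones by straight segments. Turning the picture upside down
  exchanges the two chains, so all layers are copies of one frame, scaled by powers of 8 and
  reflected alternately. A disjoint chain adjusts the height.
\<close>

section \<open>Dimension and standard examples\<close>

lemma partial_order_onE:
  assumes "partial_order_on A r"
  obtains "r \<subseteq> A \<times> A" "\<And>x. x \<in> A \<Longrightarrow> (x, x) \<in> r"
    "\<And>x y z. (x, y) \<in> r \<Longrightarrow> (y, z) \<in> r \<Longrightarrow> (x, z) \<in> r"
    "\<And>x y. (x, y) \<in> r \<Longrightarrow> (y, x) \<in> r \<Longrightarrow> x = y"
proof (rule that)
  show "r \<subseteq> A \<times> A" "\<And>x. x \<in> A \<Longrightarrow> (x, x) \<in> r"
    using assms by (simp_all add: partial_order_on_def preorder_on_def refl_on_def)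
  have "trans r" "antisym r"
    using assms by (simp_all add: partial_order_on_def preorder_on_def)
  then show "\<And>x y z. (x, y) \<in> r \<Longrightarrow> (y, z) \<in> r \<Longrightarrow> (x, z) \<in> r"
    "\<And>x y. (x, y) \<in> r \<Longrightarrow> (y, x) \<in> r \<Longrightarrow> x = y"
    by (meson transD, meson antisymD)
qed

text \<open>The added pairs are those forced by placing \<open>u\<close> below \<open>v\<close>; a
  cycle through one of them would already give \<open>(v, u) \<in> m\<close>.\<close>

lemma partial_order_on_add_pair:
  assumes m: "partial_order_on A m" and u: "u \<in> A" and v: "v \<in> A" and vu: "(v, u) \<notin> m"
  shows "partial_order_on A (m \<union> {(p, q). (p, u) \<in> m \<and> (v, q) \<in> m})"
proof -
  have sub: "m \<subseteq> A \<times> A" and refl: "\<And>x. x \<in> A \<Longrightarrow> (x, x) \<in> m"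
    and tr: "\<And>x y z. (x, y) \<in> m \<Longrightarrow> (y, z) \<in> m \<Longrightarrow> (x, z) \<in> m"
    and asym: "\<And>x y. (x, y) \<in> m \<Longrightarrow> (y, x) \<in> m \<Longrightarrow> x = y"
    by (rule partial_order_onE[OF m]; blast)+
  let ?m = "m \<union> {(p, q). (p, u) \<in> m \<and> (v, q) \<in> m}"
  have "trans ?m"
  proof (rule transI)
    fix x y z assume "(x, y) \<in> ?m" "(y, z) \<in> ?m"
    then show "(x, z) \<in> ?m"
      using tr[of x y z] tr[of x y u] tr[of v y z] by auto
  qed
  moreover have "antisym ?m"
  proof (rule antisymI)
    fix x y assume "(x, y) \<in> ?m" "(y, x) \<in> ?m"
    then show "x = y"
      using asym[of x y] tr[of x y u] tr[of y x u] tr[of v x u] tr[of v y u] vu by auto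
  qed
  ultimately show ?thesis
    using sub refl by (auto simp: partial_order_on_def preorder_on_def refl_on_def)
qed

text \<open>Szpilrajn's theorem for finite sets: a maximal partial order above \<open>r\<close> is
  total, since an incomparable pair could still be added.\<close>

lemma finite_linear_extension:
  assumes fin: "finite A" and r: "partial_order_on A r"
  obtains l where "linear_order_on A l" "r \<subseteq> l"
proof -
  let ?F = "{m. partial_order_on A m}"
  have "finite ?F"
    by (rule finite_subset[of _ "Pow (A \<times> A)"])
      (use fin in \<open>auto simp: partial_order_on_def preorder_on_def\<close>)
  then obtain l where l: "partial_order_on A l" "r \<subseteq> l"
    and max: "\<And>m. partial_order_on A m \<Longrightarrow> l \<subseteq> m \<Longrightarrow> l = m"
    using finite_has_maximal2[of ?F r] r by auto
  have "(u, v) \<in> l \<or> (v, u) \<in> l" if "u \<in> A" "v \<in> A" for u v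
  proof (rule disjCI)
    assume "(v, u) \<notin> l"
    from max[OF partial_order_on_add_pair[OF l(1) that this]]
    have "{(p, q). (p, u) \<in> l \<and> (v, q) \<in> l} \<subseteq> l" by blast
    moreover have "(u, u) \<in> l" "(v, v) \<in> l"
      using l(1) that by (auto simp: partial_order_on_def preorder_on_def refl_on_def)
    ultimately show "(u, v) \<in> l" by blast
  qed
  with l that show thesis
    unfolding linear_order_on_def total_on_def by blast
qed

text \<open>Take all linear extensions: a pair \<open>(x, y)\<close> outside \<open>r\<close> is
  excluded by an extension with \<open>y\<close> put below \<open>x\<close>. Hence the
  \<open>LEAST\<close> in \<open>poset_dim\<close> is attained.\<close>

lemma realizer_exists:
  assumes fin: "finite A" and r: "partial_order_on A r"
  shows "\<exists>L. finite L \<and> L \<noteq> {} \<and> (\<forall>l\<in>L. linear_order_on A l) \<and> r = \<Inter>L"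
proof -
  let ?L = "{l. linear_order_on A l \<and> r \<subseteq> l}"
  have "finite ?L"
    by (rule finite_subset[of _ "Pow (A \<times> A)"])
      (use fin in \<open>auto simp: linear_order_on_def partial_order_on_def preorder_on_def\<close>)
  moreover obtain l0 where l0: "l0 \<in> ?L"
    using finite_linear_extension[OF fin r] by blast
  moreover have "(x, y) \<in> r" if xy: "(x, y) \<in> \<Inter>?L" for x y
  proof (rule ccontr)
    assume nr: "(x, y) \<notin> r"
    have A: "x \<in> A" "y \<in> A"
      using xy l0 by (auto simp: linear_order_on_def partial_order_on_def preorder_on_def)
    then have ne: "x \<noteq> y" and refl: "(x, x) \<in> r" "(y, y) \<in> r"
      using nr r by (auto simp: partial_order_on_def preorder_on_def refl_on_def)
    obtain l where l: "linear_order_on A l"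
      and sub: "r \<union> {(p, q). (p, y) \<in> r \<and> (x, q) \<in> r} \<subseteq> l"
      using finite_linear_extension[OF fin partial_order_on_add_pair[OF r A(2,1) nr]] by blast
    then have "(x, y) \<in> l" "(y, x) \<in> l"
      using refl xy by blast+
    then show False
      using l ne by (auto simp: linear_order_on_def partial_order_on_def dest: antisymD)
  qed
  ultimately show ?thesis
    by (intro exI[of _ ?L]) auto
qed

text \<open>Each pair \<open>(a i, b i)\<close> is missing from some member of a realizer. A linear
  order missing two of them would give \<open>a i \<le> b j \<le> a j \<le> b i\<close>, so distinct
  pairs need distinct members.\<close>

lemma poset_dim_ge_standard_example:
  assumes fin: "finite A" and r: "partial_order_on A r"
    and A: "\<And>i. i \<in> J \<Longrightarrow> a i \<in> A" "\<And>i. i \<in> J \<Longrightarrow> b i \<in> A"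
    and le: "\<And>i j. i \<in> J \<Longrightarrow> j \<in> J \<Longrightarrow> i \<noteq> j \<Longrightarrow> (a i, b j) \<in> r"
    and nle: "\<And>i. i \<in> J \<Longrightarrow> (a i, b i) \<notin> r"
  shows "card J \<le> poset_dim A r"
proof -
  let ?D = "\<lambda>d. \<exists>L. finite L \<and> L \<noteq> {} \<and> card L = d \<and> (\<forall>l\<in>L. linear_order_on A l) \<and> r = \<Inter>L"
  have "\<exists>d. ?D d"
    using realizer_exists[OF fin r] by blast
  then have "?D (poset_dim A r)"
    unfolding poset_dim_def by (rule LeastI_ex)
  then obtain L where L: "finite L" "card L = poset_dim A r" "r = \<Inter>L"
    and lin: "\<And>l. l \<in> L \<Longrightarrow> linear_order_on A l"
    by blast
  have "\<exists>l\<in>L. (a i, b i) \<notin> l" if "i \<in> J" for i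
    using nle[OF that] L(3) by blast
  then obtain f where f: "\<And>i. i \<in> J \<Longrightarrow> f i \<in> L" "\<And>i. i \<in> J \<Longrightarrow> (a i, b i) \<notin> f i"
    by metis
  have "inj_on f J"
  proof (rule inj_onI, rule ccontr)
    fix i j assume ij: "i \<in> J" "j \<in> J" "f i = f j" "i \<noteq> j"
    have lo: "linear_order_on A (f i)"
      using lin f(1) ij(1) by blast
    have rev: "(b k, a k) \<in> f i" if "k \<in> J" "f k = f i" for k
    proof -
      have "a k \<in> A" "b k \<in> A" "(a k, b k) \<notin> f i"
        using A f(2)[of k] that by auto
      moreover from this have "a k \<noteq> b k"
        using lo by (auto simp: order_on_defs refl_on_def)
      ultimately show ?thesis
        using lo by (auto simp: linear_order_on_def total_on_def)
    qed
    have "(a i, b j) \<in> f i" "(a j, b i) \<in> f i"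
      using le ij f(1) L(3) by auto
    with rev ij have "(a i, a j) \<in> f i" "(a j, b i) \<in> f i" "(b i, a i) \<in> f i"
      using lo by (auto simp: order_on_defs dest: transD)
    then have "(a i, b i) \<in> f i"
      using lo by (auto simp: order_on_defs dest: transD)
    with f(2) ij(1) show False by blast
  qed
  then show ?thesis
    using card_inj_on_le[of f J L] f(1) L(1,2) by auto
qed

section \<open>Orders generated by ranked relations\<close>

definition generated_order :: "'a set \<Rightarrow> ('a \<times> 'a) set \<Rightarrow> ('a \<times> 'a) set" where
  "generated_order A E = {(x, y). x \<in> A \<and> y \<in> A \<and> (x, y) \<in> E\<^sup>*}"

lemma rank_less_rtrancl:
  fixes rank :: "'a \<Rightarrow> int"
  assumes "(x, y) \<in> E\<^sup>*" and "\<And>x y. (x, y) \<in> E \<Longrightarrow> rank x < rank y"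
  shows "x = y \<or> rank x < rank y"
  using assms(1)
proof induction
  case (step y z)
  then show ?case using assms(2)[of y z] by auto
qed simp

lemma partial_order_on_generated_order:
  fixes rank :: "'a \<Rightarrow> int"
  assumes "\<And>x y. (x, y) \<in> E \<Longrightarrow> rank x < rank y"
  shows "partial_order_on A (generated_order A E)"
proof -
  have "x = y" if "(x, y) \<in> E\<^sup>*" "(y, x) \<in> E\<^sup>*" for x y
    using rank_less_rtrancl[OF that(1), of rank] rank_less_rtrancl[OF that(2), of rank] assms
    by fastforce
  then show ?thesis
    unfolding partial_order_on_def preorder_on_def
    by (auto simp: generated_order_def refl_on_def intro!: transI antisymI)
qed

text \<open>The first edge of an \<open>E\<close>-path from \<open>a\<close> to \<open>b\<close>
  ends between them, for a cover necessarily in \<open>b\<close>. So crossings need only be checked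
  on \<open>E\<close>.\<close>

lemma cover_relations_generated_order:
  fixes rank :: "'a \<Rightarrow> int"
  assumes rank: "\<And>x y. (x, y) \<in> E \<Longrightarrow> rank x < rank y" and E: "E \<subseteq> A \<times> A"
  shows "cover_relations (generated_order A E) \<subseteq> E"
proof safe
  fix a b assume ab: "(a, b) \<in> cover_relations (generated_order A E)"
  then have "(a, b) \<in> E\<^sup>*" "a \<noteq> b" and A: "a \<in> A" "b \<in> A"
    by (auto simp: cover_relations_def generated_order_def)
  then obtain c where c: "(a, c) \<in> E" "(c, b) \<in> E\<^sup>*"
    by (meson converse_rtranclE)
  have "(a, c) \<in> generated_order A E" "(c, b) \<in> generated_order A E"
    using c A E by (auto simp: generated_order_def)
  moreover have "c \<noteq> a"
    using rank[OF c(1)] by auto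
  ultimately have "c = b"
    using ab by (auto simp: cover_relations_def)
  with c show "(a, b) \<in> E" by simp
qed

text \<open>A strictly increasing rank is injective on chains, so its \<open>h\<close> values bound
  the height; \<open>C\<close> attains the bound.\<close>

lemma poset_height_eqI:
  fixes rank :: "'a \<Rightarrow> int"
  assumes rank: "\<And>x y. (x, y) \<in> r \<Longrightarrow> x \<noteq> y \<Longrightarrow> rank x < rank y"
    and range: "\<And>x. x \<in> Field r \<Longrightarrow> rank x \<in> {0..<int h}"
    and C: "C \<in> Chains r" "card C = h"
  shows "poset_height r = h"
proof -
  have le: "card D \<le> h" if "D \<in> Chains r" for D
  proof -
    have D: "\<And>x y. x \<in> D \<Longrightarrow> y \<in> D \<Longrightarrow> (x, y) \<in> r \<or> (y, x) \<in> r"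
      using that by (auto simp: Chains_def)
    have "inj_on rank D"
      using D rank by (metis inj_onI less_irrefl)
    moreover have "rank ` D \<subseteq> {0..<int h}"
      using D range by (metis FieldI1 image_subsetI)
    ultimately show ?thesis
      using card_inj_on_le[of rank D "{0..<int h}"] by simp
  qed
  then have "card ` Chains r \<subseteq> {..h}"
    by auto
  then have "finite (card ` Chains r)"
    by (rule finite_subset) simp
  then show ?thesis
    unfolding poset_height_def using le C by (intro Max_eqI) auto
qed

section \<open>Renaming elements and straight-line diagrams\<close>

lemma cover_relations_image:
  assumes f: "inj f"
  shows "cover_relations (map_prod f f ` r) = map_prod f f ` cover_relations r"
proof -
  define R where "R = map_prod f f ` r"
  have mem: "(f x, f y) \<in> R \<longleftrightarrow> (x, y) \<in> r" for x y
    using f by (auto simp: R_def dest: injD)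
  have range: "R \<subseteq> range f \<times> range f"
    by (auto simp: R_def)
  have "(\<exists>c. c \<noteq> f x \<and> c \<noteq> f y \<and> (f x, c) \<in> R \<and> (c, f y) \<in> R) \<longleftrightarrow>
      (\<exists>z. f z \<noteq> f x \<and> f z \<noteq> f y \<and> (f x, f z) \<in> R \<and> (f z, f y) \<in> R)" for x y
    using range by blast
  then have "(f x, f y) \<in> cover_relations R \<longleftrightarrow> (x, y) \<in> cover_relations r" for x y
    unfolding cover_relations_def mem_Collect_eq prod.case by (simp only: mem inj_eq[OF f])
  moreover have "cover_relations R \<subseteq> range f \<times> range f"
    using range by (auto simp: cover_relations_def)
  ultimately have "cover_relations R = map_prod f f ` cover_relations r"
    by (fastforce simp: map_prod_def)
  then show ?thesis
    by (simp add: R_def)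
qed

lemma partial_order_on_image:
  assumes f: "inj f" and r: "partial_order_on A r"
  shows "partial_order_on (f ` A) (map_prod f f ` r)"
proof -
  have sub: "r \<subseteq> A \<times> A" and refl: "\<And>x. x \<in> A \<Longrightarrow> (x, x) \<in> r"
    and tr: "\<And>x y z. (x, y) \<in> r \<Longrightarrow> (y, z) \<in> r \<Longrightarrow> (x, z) \<in> r"
    and asym: "\<And>x y. (x, y) \<in> r \<Longrightarrow> (y, x) \<in> r \<Longrightarrow> x = y"
    by (rule partial_order_onE[OF r]; blast)+
  show ?thesis
    unfolding partial_order_on_def preorder_on_def refl_on_def
  proof (intro conjI transI antisymI)
    fix x y z assume "(x, y) \<in> map_prod f f ` r" "(y, z) \<in> map_prod f f ` r"
    then show "(x, z) \<in> map_prod f f ` r"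
      using tr by (auto simp: inj_eq[OF f])
  next
    fix x y assume "(x, y) \<in> map_prod f f ` r" "(y, x) \<in> map_prod f f ` r"
    then show "x = y"
      using asym by (auto simp: inj_eq[OF f])
  qed (use sub refl in auto)
qed

text \<open>Lets the poset be built on a convenient type and be moved to the natural numbers at the
  end.\<close>

lemma planar_poset_image:
  assumes f: "inj f" and pl: "planar_poset A r"
  shows "planar_poset (f ` A) (map_prod f f ` r)"
proof -
  obtain p \<gamma> where p: "is_diagram A r p \<gamma>" "crossing_free A r p \<gamma>"
    using pl by (auto simp: planar_poset_def)
  let ?p = "p \<circ> inv f" and ?\<gamma> = "\<lambda>e. \<gamma> (map_prod (inv f) (inv f) e)"
  have "is_diagram (f ` A) (map_prod f f ` r) ?p ?\<gamma>"
    using p(1) unfolding is_diagram_def cover_relations_image[OF f]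
    by (simp add: split_beta inj_on_def inv_f_f[OF f] inj_eq[OF f])
  moreover have "crossing_free (f ` A) (map_prod f f ` r) ?p ?\<gamma>"
    using p(2) unfolding crossing_free_def cover_relations_image[OF f]
    by (simp add: split_beta inv_f_f[OF f] inj_eq[OF f])
  ultimately show ?thesis
    using pl partial_order_on_image[OF f] by (auto simp: planar_poset_def)
qed

text \<open>\<open>E\<close> may contain more than the covers. By \<open>inc\<close> every point is
  an end of some segment, so a point lying on a foreign segment is caught by
  \<open>cross\<close>.\<close>

lemma planar_posetI_straight_line:
  fixes p :: "'a \<Rightarrow> real \<times> real"
  assumes fin: "finite A" and r: "partial_order_on A r" and E: "cover_relations r \<subseteq> E"
    and inj: "inj_on p A" and sub: "E \<subseteq> A \<times> A"
    and up: "\<And>a b. (a, b) \<in> E \<Longrightarrow> snd (p a) < snd (p b)"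
    and inc: "\<And>c. c \<in> A \<Longrightarrow> E \<noteq> {} \<Longrightarrow> c \<in> Field E"
    and cross: "\<And>a b c d. (a, b) \<in> E \<Longrightarrow> (c, d) \<in> E \<Longrightarrow> (a, b) \<noteq> (c, d) \<Longrightarrow>
      closed_segment (p a) (p b) \<inter> closed_segment (p c) (p d) \<subseteq> {p a, p b} \<inter> {p c, p d}"
  shows "planar_poset A r"
proof -
  let ?\<gamma> = "\<lambda>(a, b). linepath (p a) (p b)"
  have "strict_mono_on {0..1} (\<lambda>t. snd (linepath (p a) (p b) t))" if "(a, b) \<in> E" for a b
  proof (rule strict_mono_onI)
    fix s t :: real assume "s < t"
    moreover have "snd (linepath (p a) (p b) t) = snd (p a) + t * (snd (p b) - snd (p a))" for t
      by (simp add: linepath_def algebra_simps)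
    ultimately show "snd (linepath (p a) (p b) s) < snd (linepath (p a) (p b) t)"
      using up[OF that] by simp
  qed
  then have "is_diagram A r p ?\<gamma>"
    using E inj by (auto simp: is_diagram_def)
  moreover have "c = a \<or> c = b" if ab: "(a, b) \<in> E" and c: "c \<in> A"
    and pc: "p c \<in> closed_segment (p a) (p b)" for a b c
  proof -
    obtain u v where uv: "(u, v) \<in> E" "c = u \<or> c = v"
      using inc[OF c] ab by (auto simp: Field_def)
    show ?thesis
    proof (cases "(u, v) = (a, b)")
      case False
      then have "p c \<in> {p a, p b}"
        using cross[OF ab uv(1)] pc uv(2) by auto
      then show ?thesis
        using inj c sub ab by (auto dest: inj_onD)
    qed (use uv in auto)
  qed
  then have "crossing_free A r p ?\<gamma>"
    unfolding crossing_free_def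
  proof (intro conjI ballI case_prodI2 impI, goal_cases)
    case (2 e a b e' c d)
    then show ?case
      using cross[of a b c d] E by (simp add: subsetD)
  qed (use E in auto)
  ultimately show ?thesis
    using fin r by (auto simp: planar_poset_def)
qed

section \<open>The layered poset\<close>

text \<open>
  \<open>P\<close> and \<open>Q\<close> are the top and the bottom of the unreflected frame of a layer (\<open>t\<close> and \<open>s\<close> in odd layers, \<open>s\<close> and
  \<open>t\<close> in even ones), \<open>Ou\<close> and \<open>In\<close> its outer and inner nodes (\<open>a\<close> and \<open>b\<close>, or \<open>b\<close> and \<open>a\<close>); the Boolean
  is the side, left or right. \<open>Z\<close> is the disjoint chain.
\<close>

datatype node = P nat | Q nat | Ou nat bool | In nat bool | W nat bool | Z nat

text \<open>The letters name the two ends. \<open>T\<close> is the top terminal of the previous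
  layers; \<open>P\<close> is their bottom terminal in \<open>WP\<close>, but the top of the new
  frame in \<open>OP\<close> and \<open>TP\<close>.\<close>

datatype strut = QW | WP | WI | OW | OP | TI | TP | QI | OI

instance node :: countable
  by countable_datatype

text \<open>
  The previous layer is reflected, so its \<open>Q (g - 1)\<close> is the top terminal and its \<open>P (g - 1)\<close> the
  bottom one. The innermost layer consists of \<open>OP\<close>, \<open>QI\<close>, \<open>OI\<close> only and has no \<open>W\<close>: a saving of 1 in
  height without which the bound would fail for some \<open>h\<close>.
\<close>

fun ends :: "nat \<Rightarrow> bool \<Rightarrow> strut \<Rightarrow> node \<times> node" where
  "ends g c QW = (Q g, W g c)"
| "ends g c WP = (W g c, P (g - 1))"
| "ends g c WI = (W g c, In g c)"
| "ends g c OW = (Ou g c, W g c)"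
| "ends g c OP = (Ou g c, P g)"
| "ends g c TI = (Q (g - 1), In g c)"
| "ends g c TP = (Q (g - 1), P g)"
| "ends g c QI = (Q g, In g c)"
| "ends g c OI = (Ou g c, In g c)"

definition struts :: "nat \<Rightarrow> strut set" where
  "struts g = (if g = 0 then {OP, QI, OI} else {QW, WP, WI, OW, OP, TI, TP})"

text \<open>Even layers are drawn upside down, so their struts are directed the other way.\<close>

definition edge :: "nat \<Rightarrow> bool \<Rightarrow> strut \<Rightarrow> node \<times> node" where
  "edge g c s = (if odd g then ends g c s else prod.swap (ends g c s))"

definition edges :: "nat \<Rightarrow> nat \<Rightarrow> (node \<times> node) set" where
  "edges N h = {edge g c s | g c s. g < N \<and> s \<in> struts g} \<union> {(Z i, Z (Suc i)) | i. Suc i < h}"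

definition nodes :: "nat \<Rightarrow> nat \<Rightarrow> node set" where
  "nodes N h = P ` {..<N} \<union> Q ` {..<N} \<union> case_prod Ou ` ({..<N} \<times> UNIV) \<union>
     case_prod In ` ({..<N} \<times> UNIV) \<union> case_prod W ` ({0<..<N} \<times> UNIV) \<union> Z ` {..<h}"

lemma finite_nodes: "finite (nodes N h)"
  by (simp add: nodes_def)

lemma edges_cases:
  assumes "e \<in> edges N h"
  obtains g c s where "g < N" "s \<in> struts g" "e = edge g c s"
  | i where "Suc i < h" "e = (Z i, Z (Suc i))"
  using assms unfolding edges_def by blast

lemma edges_subset: "edges N h \<subseteq> nodes N h \<times> nodes N h"
proof
  fix e assume "e \<in> edges N h"
  then show "e \<in> nodes N h \<times> nodes N h"
  proof (cases rule: edges_cases)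
    case (1 g c s)
    then show ?thesis
      by (cases s) (auto simp: struts_def edge_def nodes_def split: if_splits)
  qed (auto simp: nodes_def)
qed

subsection \<open>Order relations\<close>

text \<open>Nodes \<open>t\<close> are counted from the bottom, nodes \<open>s\<close> from the top.
  \<open>W j\<close> comes directly below the \<open>t\<close> of its layer if \<open>j\<close> is
  even, directly above the \<open>s\<close> if \<open>j\<close> is odd. For \<open>N > 0\<close> the
  lowest \<open>s\<close>, in layer \<open>N - 1\<close>, has a nonnegative level exactly if
  \<open>N + 1 + N div 2 \<le> h\<close>.\<close>

definition level :: "nat \<Rightarrow> node \<Rightarrow> int" where
  "level h x = (case x of
     P j \<Rightarrow> if odd j then int (1 + j + j div 2) else int h - int (2 + j + (j + 1) div 2)
   | Q j \<Rightarrow> if even j then int (1 + j + j div 2) else int h - int (2 + j + (j + 1) div 2)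
   | Ou j _ \<Rightarrow> if odd j then 0 else int h - 1
   | In j _ \<Rightarrow> if even j then 0 else int h - 1
   | W j _ \<Rightarrow> if even j then int (j + j div 2) else int h - int (1 + j + (j + 1) div 2)
   | Z i \<Rightarrow> int i)"

lemma level_edges:
  assumes h: "N + 1 + N div 2 \<le> h" and e: "(x, y) \<in> edges N h"
  shows "level h x < level h y"
  using e
proof (cases rule: edges_cases)
  case (1 g c s)
  show ?thesis
  proof (cases "odd g")
    case True
    then obtain k where "g = 2 * k + 1" by (elim oddE)
    with 1 h show ?thesis
      by (cases s) (auto simp: level_def edge_def struts_def)
  next
    case False
    then obtain k where k: "g = 2 * k" by (auto elim: evenE)
    show ?thesis
    proof (cases k)
      case 0
      with k 1 h show ?thesis
        by (cases s) (auto simp: level_def edge_def struts_def)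
    next
      case (Suc l)
      with k 1 h show ?thesis
        by (cases s) (auto simp: level_def edge_def struts_def)
    qed
  qed
qed (simp add: level_def)

lemma level_range:
  assumes h: "N = 0 \<or> N + 1 + N div 2 \<le> h" and x: "x \<in> nodes N h"
  shows "level h x \<in> {0..<int h}"
proof -
  have "g < N \<Longrightarrow> 2 + g + (g + 1) div 2 \<le> h" "g < N \<Longrightarrow> 1 + g + g div 2 < h" for g
    using h by auto
  then show ?thesis
    using x by (fastforce simp: nodes_def level_def)
qed

section \<open>The standard example in the layered poset\<close>

definition tn :: "nat \<Rightarrow> node" where "tn j = (if odd j then P j else Q j)"
definition sn :: "nat \<Rightarrow> node" where "sn j = (if odd j then Q j else P j)"
definition an :: "nat \<Rightarrow> bool \<Rightarrow> node" where "an g c = (if odd g then Ou g c else In g c)"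
text \<open>The partner of \<open>an g c\<close> is on the opposite side, because the struts of a
  layer put \<open>an g c\<close> below the node on its own side.\<close>

definition bn :: "nat \<Rightarrow> bool \<Rightarrow> node" where "bn g c = (if odd g then In g (\<not> c) else Ou g (\<not> c))"

lemma ab_nodes: "g < N \<Longrightarrow> an g c \<in> nodes N h" "g < N \<Longrightarrow> bn g c \<in> nodes N h"
  by (auto simp: an_def bn_def nodes_def)

lemma edge_mem_edges: "g < N \<Longrightarrow> s \<in> struts g \<Longrightarrow> edge g c s \<in> edges N h"
  unfolding edges_def by blast

text \<open>Each relation is a single strut or a path of two struts through a node \<open>W\<close>;
  even layers are the upside-down version of odd ones.\<close>

lemma outer_layer_reach:
  assumes g: "g < N" "0 < g"
  shows "(an g c, tn g) \<in> (edges N h)\<^sup>*" "(sn g, bn g c) \<in> (edges N h)\<^sup>*"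
    "(an g c, bn g (\<not> c)) \<in> (edges N h)\<^sup>*" "(an g c, sn (g - 1)) \<in> (edges N h)\<^sup>*"
    "(tn (g - 1), bn g c) \<in> (edges N h)\<^sup>*" "(tn (g - 1), tn g) \<in> (edges N h)\<^sup>*"
    "(sn g, sn (g - 1)) \<in> (edges N h)\<^sup>*"
proof -
  let ?R = "(edges N h)\<^sup>*"
  have one: "edge g d s \<in> ?R" if "s \<in> struts g" for s d
    using edge_mem_edges[OF g(1) that] by auto
  have S: "QW \<in> struts g" "WP \<in> struts g" "WI \<in> struts g" "OW \<in> struts g" "OP \<in> struts g"
      "TI \<in> struts g" "TP \<in> struts g"
    using g(2) by (auto simp: struts_def)
  note one = S[THEN one]
  show "(an g c, tn g) \<in> ?R" "(sn g, bn g c) \<in> ?R" "(an g c, bn g (\<not> c)) \<in> ?R"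
    "(an g c, sn (g - 1)) \<in> ?R" "(tn (g - 1), bn g c) \<in> ?R" "(tn (g - 1), tn g) \<in> ?R"
    "(sn g, sn (g - 1)) \<in> ?R"
    using one(1)[of c] one(2)[of c] one(3)[of c] one(4)[of c] one(5)[of c] one(6)[of c] one(7)[of c]
      one(1)[of "\<not> c"] one(2)[of "\<not> c"] one(3)[of "\<not> c"] one(4)[of "\<not> c"] one(5)[of "\<not> c"]
      one(6)[of "\<not> c"] g
    unfolding edge_def tn_def sn_def an_def bn_def
    by (cases "odd g"; simp; meson rtrancl_trans)+
qed

lemma layer_reach:
  assumes g: "g < N"
  shows "(an g c, tn g) \<in> (edges N h)\<^sup>*" "(sn g, bn g c) \<in> (edges N h)\<^sup>*"
    "(an g c, bn g (\<not> c)) \<in> (edges N h)\<^sup>*"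
proof -
  have "edge 0 c QI \<in> (edges N h)\<^sup>*" "edge 0 (\<not> c) OP \<in> (edges N h)\<^sup>*" "edge 0 c OI \<in> (edges N h)\<^sup>*"
    if "0 < N"
    using edge_mem_edges[OF that, of _ _ h] by (auto simp: struts_def)
  then show "(an g c, tn g) \<in> (edges N h)\<^sup>*" "(sn g, bn g c) \<in> (edges N h)\<^sup>*"
    "(an g c, bn g (\<not> c)) \<in> (edges N h)\<^sup>*"
    using outer_layer_reach[OF g] g
    by (cases "g = 0"; simp add: edge_def tn_def sn_def an_def bn_def)+
qed

lemma tn_reach: "i \<le> j \<Longrightarrow> j < N \<Longrightarrow> (tn i, tn j) \<in> (edges N h)\<^sup>*"
proof (induction j rule: dec_induct)
  case (step j)
  then show ?case
    using outer_layer_reach(6)[of "Suc j" N h] by (auto intro: rtrancl_trans)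
qed simp

lemma sn_reach: "i \<le> j \<Longrightarrow> j < N \<Longrightarrow> (sn j, sn i) \<in> (edges N h)\<^sup>*"
proof (induction j rule: dec_induct)
  case (step j)
  then show ?case
    using outer_layer_reach(7)[of "Suc j" N h] by (auto intro: rtrancl_trans)
qed simp

lemma an_le_bn:
  assumes "g < N" "g' < N" "(g, c) \<noteq> (g', c')"
  shows "(an g c, bn g' c') \<in> (edges N h)\<^sup>*"
proof (cases g g' rule: linorder_cases)
  case less
  \<comment> \<open>The chain is left one layer early: \<open>bn g' c'\<close> is attached to
    \<open>tn (g' - 1)\<close>.\<close>
  then have "(tn g, tn (g' - 1)) \<in> (edges N h)\<^sup>*"
    using assms by (intro tn_reach) auto
  moreover have "(tn (g' - 1), bn g' c') \<in> (edges N h)\<^sup>*"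
    using less assms by (intro outer_layer_reach) auto
  ultimately show ?thesis
    using layer_reach(1)[OF assms(1), of c h] by (meson rtrancl_trans)
next
  case equal
  then have "c' = (\<not> c)" using assms(3) by auto
  then show ?thesis
    using layer_reach(3)[OF assms(1)] equal by simp
next
  case greater
  then have "(sn (g - 1), sn g') \<in> (edges N h)\<^sup>*"
    using assms by (intro sn_reach) auto
  moreover have "(an g c, sn (g - 1)) \<in> (edges N h)\<^sup>*"
    using greater assms by (intro outer_layer_reach) auto
  ultimately show ?thesis
    using layer_reach(2)[OF assms(2), of c' h] by (meson rtrancl_trans)
qed

text \<open>An up-closed set containing \<open>an g c\<close> but not \<open>bn g c\<close>.\<close>

definition above :: "nat \<Rightarrow> bool \<Rightarrow> node \<Rightarrow> bool" where
  "above g c x = (case x of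
     P j \<Rightarrow> if odd j then g \<le> j else j < g
   | Q j \<Rightarrow> if even j then g \<le> j else j < g
   | Ou j d \<Rightarrow> if odd j then j = g \<and> d = c else \<not> (j = g \<and> d = (\<not> c))
   | In j d \<Rightarrow> if even j then j = g \<and> d = c else \<not> (j = g \<and> d = (\<not> c))
   | W j d \<Rightarrow> if j = g then d = c else if odd j then j < g else g < j
   | Z i \<Rightarrow> False)"

text \<open>The delicate nodes are the two parallel \<open>W\<close> of layer \<open>g\<close>: only
  the one on side \<open>c\<close> is in the set, and neither lower neighbour of the other one
  is.\<close>

lemma above_edges:
  assumes "(x, y) \<in> edges N h" "above g c x"
  shows "above g c y"
  using assms(1)
proof (cases rule: edges_cases)
  case (1 g' c' s)
  then show ?thesis
    using assms(2) by (cases s) (auto simp: above_def edge_def struts_def split: if_splits)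
qed (use assms(2) in \<open>auto simp: above_def\<close>)

lemma an_not_le_bn: "(an g c, bn g c) \<notin> (edges N h)\<^sup>*"
proof
  have above: "above g c y" if "(x, y) \<in> (edges N h)\<^sup>*" "above g c x" for x y
    using that by induction (auto intro: above_edges)
  assume "(an g c, bn g c) \<in> (edges N h)\<^sup>*"
  from above[OF this] show False
    by (cases "odd g") (simp_all add: above_def an_def bn_def)
qed

subsection \<open>The drawing\<close>

text \<open>
  The right half of the frame around the previous layers, which fill the square \<open>[-1, 1]\<^sup>2\<close> and
  touch its boundary only in the terminals \<open>(0, 1)\<close> and \<open>(0, -1)\<close>; the frame itself lies in
  \<open>[-8, 8]\<^sup>2\<close>. The left half is its mirror image.
\<close>

fun frame :: "strut \<Rightarrow> (real \<times> real) \<times> (real \<times> real)" where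
  "frame QW = ((0, -8), (2, -2))"
| "frame WP = ((2, -2), (0, -1))"
| "frame WI = ((2, -2), (2, 2))"
| "frame OW = ((4, -3), (2, -2))"
| "frame OP = ((4, -3), (0, 8))"
| "frame TI = ((0, 1), (2, 2))"
| "frame TP = ((0, 1), (0, 8))"
| "frame QI = ((0, -8), (2, 2))"
| "frame OI = ((4, -3), (2, 2))"

definition frame_ends :: "strut \<Rightarrow> (real \<times> real) set" where
  "frame_ends s = {fst (frame s), snd (frame s)}"

definition frame_seg :: "strut \<Rightarrow> (real \<times> real) set" where
  "frame_seg s = closed_segment (fst (frame s)) (snd (frame s))"

text \<open>The line of each segment with a range for one coordinate turns incidence questions into
  linear arithmetic.\<close>

fun on_line :: "strut \<Rightarrow> real \<Rightarrow> real \<Rightarrow> bool" where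
  "on_line QW x y \<longleftrightarrow> y = 3 * x - 8 \<and> 0 \<le> x \<and> x \<le> 2"
| "on_line WP x y \<longleftrightarrow> 2 * y = - 2 - x \<and> 0 \<le> x \<and> x \<le> 2"
| "on_line WI x y \<longleftrightarrow> x = 2 \<and> - 2 \<le> y \<and> y \<le> 2"
| "on_line OW x y \<longleftrightarrow> 2 * y = - 2 - x \<and> 2 \<le> x \<and> x \<le> 4"
| "on_line OP x y \<longleftrightarrow> 4 * y = 32 - 11 * x \<and> 0 \<le> x \<and> x \<le> 4"
| "on_line TI x y \<longleftrightarrow> 2 * y = 2 + x \<and> 0 \<le> x \<and> x \<le> 2"
| "on_line TP x y \<longleftrightarrow> x = 0 \<and> 1 \<le> y \<and> y \<le> 8"
| "on_line QI x y \<longleftrightarrow> y = 5 * x - 8 \<and> 0 \<le> x \<and> x \<le> 2"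
| "on_line OI x y \<longleftrightarrow> 2 * y = 14 - 5 * x \<and> 2 \<le> x \<and> x \<le> 4"

lemma on_line_frame_seg: "z \<in> frame_seg s \<Longrightarrow> on_line s (fst z) (snd z)"
  by (cases s) (auto simp: frame_seg_def in_segment algebra_simps)

text \<open>Only struts of a common layer are compared: the segments of \<open>QI\<close> and
  \<open>WP\<close> do cross, but no layer has both.\<close>

lemma frame_seg_inter:
  assumes "s \<in> struts g" "s' \<in> struts g" "s \<noteq> s'" "z \<in> frame_seg s" "z \<in> frame_seg s'"
  shows "z \<in> frame_ends s"
proof -
  have L: "on_line s (fst z) (snd z)" "on_line s' (fst z) (snd z)"
    using assms on_line_frame_seg by auto
  show ?thesis
    using assms(1-3) L
    by (cases s; cases s'; cases z)
      (simp_all add: struts_def frame_ends_def split: if_splits)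
qed

section \<open>Separation of nested layers and of mirror halves\<close>

definition supn :: "real \<times> real \<Rightarrow> real" where
  "supn z = max \<bar>fst z\<bar> \<bar>snd z\<bar>"

lemma supn_frame_seg_le: "z \<in> frame_seg s \<Longrightarrow> supn z \<le> 8"
  using on_line_frame_seg[of z s] by (cases s) (auto simp: supn_def)

lemma supn_frame_seg_outer: "z \<in> frame_seg s \<Longrightarrow> supn z = 8 \<Longrightarrow> z \<in> frame_ends s"
  using on_line_frame_seg[of z s]
  by (cases s; cases z) (auto simp: supn_def frame_ends_def max_def abs_if split: if_splits)

lemma supn_frame_seg_ge: "z \<in> frame_seg s \<Longrightarrow> s \<in> struts g \<Longrightarrow> 0 < g \<Longrightarrow> 1 \<le> supn z"
  using on_line_frame_seg[of z s]
  by (cases s) (auto simp: supn_def struts_def max_def abs_if)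

lemma supn_frame_seg_inner:
  "z \<in> frame_seg s \<Longrightarrow> s \<in> struts g \<Longrightarrow> 0 < g \<Longrightarrow> supn z = 1 \<Longrightarrow> z \<in> frame_ends s"
  using on_line_frame_seg[of z s]
  by (cases s; cases z) (auto simp: supn_def frame_ends_def struts_def max_def abs_if split: if_splits)

lemma fst_frame_seg_nonneg: "z \<in> frame_seg s \<Longrightarrow> 0 \<le> fst z"
  using on_line_frame_seg[of z s] by (cases s) auto

text \<open>\<open>TP\<close> runs along the mirror axis; all other struts reach the axis only in
  their ends, which keeps the two halves apart.\<close>

lemma fst_frame_seg_zero: "z \<in> frame_seg s \<Longrightarrow> fst z = 0 \<Longrightarrow> s \<noteq> TP \<Longrightarrow> z \<in> frame_ends s"
  using on_line_frame_seg[of z s] by (cases s; cases z) (auto simp: frame_ends_def)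

text \<open>\<open>c\<close> selects the half, the parity of \<open>g\<close> the reflection. The
  factor is \<open>8 ^ (g - 1)\<close> for \<open>g > 0\<close>; the quotient extends it to layer 0,
  which then lies in the square inside the frame of layer 1.\<close>

definition emb :: "nat \<Rightarrow> bool \<Rightarrow> real \<times> real \<Rightarrow> real \<times> real" where
  "emb g c z = ((if c then 1 else -1) * (8 ^ g / 8) * fst z, (if odd g then 1 else -1) * (8 ^ g / 8) * snd z)"

lemma linear_emb: "linear (emb g c)"
  by (rule linearI) (auto simp: emb_def algebra_simps)

lemma inj_emb: "inj (emb g c)"
  by (rule injI) (auto simp: emb_def prod_eq_iff split: if_splits)

lemma emb_eq_iff:
  "emb g c u = emb g d v \<longleftrightarrow> fst u = (if c = d then fst v else - fst v) \<and> snd u = snd v"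
  by (simp add: emb_def minus_equation_iff[of "fst u"] eq_commute[of "- fst v"])

lemma supn_emb: "supn (emb g c z) = 8 ^ g / 8 * supn z"
  by (simp add: supn_def emb_def abs_mult max_mult_distrib_left)

text \<open>\<open>P\<close> and \<open>Q\<close> lie on the axis, so either side gives the same
  point. The chain \<open>Z\<close> stands on the vertical line at \<open>8 ^ N\<close>, to the
  right of all layers below \<open>N\<close>.\<close>

fun pos :: "nat \<Rightarrow> node \<Rightarrow> real \<times> real" where
  "pos N (P g) = emb g True (0, 8)"
| "pos N (Q g) = emb g True (0, -8)"
| "pos N (Ou g c) = emb g c (4, -3)"
| "pos N (In g c) = emb g c (2, 2)"
| "pos N (W g c) = emb g c (2, -2)"
| "pos N (Z i) = (8 ^ N, real i)"

text \<open>Consecutive frames fit: the change of scale and the reflection make the outer terminals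
  \<open>(0, -8)\<close> and \<open>(0, 8)\<close> of layer \<open>g - 1\<close> the inner terminals
  \<open>(0, 1)\<close> and \<open>(0, -1)\<close> of layer \<open>g\<close>.\<close>

lemma pos_ends:
  assumes "s \<in> struts g"
  shows "pos N (fst (ends g c s)) = emb g c (fst (frame s))"
    and "pos N (snd (ends g c s)) = emb g c (snd (frame s))"
proof -
  have "(8::real) ^ (g - Suc 0) = 8 ^ g / 8" "odd (g - Suc 0) \<longleftrightarrow> even g" if "0 < g"
    using that by (cases g; simp)+
  then show "pos N (fst (ends g c s)) = emb g c (fst (frame s))"
    "pos N (snd (ends g c s)) = emb g c (snd (frame s))"
    using assms by (cases s; auto simp: emb_def struts_def split: if_splits)+
qed

lemma edge_drawing:
  assumes "s \<in> struts g" "(a, b) = edge g c s"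
  shows "closed_segment (pos N a) (pos N b) = emb g c ` frame_seg s"
    and "{pos N a, pos N b} = emb g c ` frame_ends s"
proof -
  have "(a = fst (ends g c s) \<and> b = snd (ends g c s)) \<or> (a = snd (ends g c s) \<and> b = fst (ends g c s))"
    using assms(2) by (cases "ends g c s") (auto simp: edge_def split: if_splits)
  then show "closed_segment (pos N a) (pos N b) = emb g c ` frame_seg s"
    "{pos N a, pos N b} = emb g c ` frame_ends s"
    using pos_ends[OF assms(1), of N c]
    by (auto simp: frame_seg_def frame_ends_def closed_segment_linear_image[OF linear_emb]
        closed_segment_commute)
qed

text \<open>Every frame segment ascends, and \<open>edge\<close> swaps the ends exactly when
  \<open>emb\<close> turns the frame over.\<close>

lemma pos_up:
  assumes "(x, y) \<in> edges N h"
  shows "snd (pos N x) < snd (pos N y)"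
  using assms
proof (cases rule: edges_cases)
  case (1 g c s)
  have "snd (fst (frame s)) < snd (snd (frame s))"
    by (cases s) auto
  then show ?thesis
    using pos_ends[OF 1(2), of N c] 1(3)
    by (cases "ends g c s") (auto simp: edge_def emb_def split: if_splits)
qed simp

text \<open>Different layers are separated by the sup norm, struts in one half by
  \<open>frame_seg_inter\<close>, opposite halves by the axis. \<open>TP\<close> belongs to both
  halves and is moved to the half of the other strut.\<close>

lemma edge_cross:
  assumes s: "g < N" "s \<in> struts g" and s': "g' < N" "s' \<in> struts g'"
    and ne: "edge g c s \<noteq> edge g' c' s'"
    and z: "z \<in> emb g c ` frame_seg s" "z \<in> emb g' c' ` frame_seg s'"
  shows "z \<in> emb g c ` frame_ends s \<and> z \<in> emb g' c' ` frame_ends s'"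
proof -
  have diff: "z \<in> emb i d ` frame_ends t \<and> z \<in> emb j d' ` frame_ends t'"
    if ij: "i < j" and t: "t' \<in> struts j" and zs: "z \<in> emb i d ` frame_seg t" "z \<in> emb j d' ` frame_seg t'"
    for i j d d' t t'
  proof -
    obtain u v where uv: "u \<in> frame_seg t" "z = emb i d u" "v \<in> frame_seg t'" "z = emb j d' v"
      using zs by auto
    have "8 ^ i / 8 * supn u = 8 ^ j / 8 * supn v"
      using supn_emb uv(2,4) by metis
    then have eq: "8 ^ i * supn u = 8 ^ j * supn v"
      by simp
    have u8: "supn u \<le> 8" and v1: "1 \<le> supn v"
      using supn_frame_seg_le uv supn_frame_seg_ge[OF uv(3) t] ij by auto
    \<comment> \<open>A common point has norm at most \<open>8 ^ i\<close> and at least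
      \<open>8 ^ j / 8\<close>; as \<open>i < j\<close>, both bounds are attained, and there the
      segments have only ends.\<close>
    have "(8::real) * 8 ^ i \<le> 8 ^ j"
      using ij power_increasing[of "Suc i" j "8::real"] by simp
    moreover have "(8::real) ^ j \<le> 8 ^ j * supn v" "8 ^ i * supn u \<le> 8 ^ i * 8"
      using u8 v1 by auto
    ultimately have "8 ^ j * supn v = (8::real) ^ j" "8 ^ i * supn u = (8::real) ^ i * 8"
      using eq by linarith+
    then have "supn v = 1" "supn u = 8"
      by auto
    then show ?thesis
      using supn_frame_seg_outer[OF uv(1)] supn_frame_seg_inner[OF uv(3) t] ij uv(2,4) by blast
  qed
  have same: "z \<in> emb i d ` frame_ends t \<and> z \<in> emb i d ` frame_ends t'"
    if t: "t \<in> struts i" "t' \<in> struts i" "t \<noteq> t'"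
      and zs: "z \<in> emb i d ` frame_seg t" "z \<in> emb i d ` frame_seg t'" for i d t t'
  proof -
    obtain u where u: "u \<in> frame_seg t" "z = emb i d u"
      using zs by auto
    then have "u \<in> frame_seg t'"
      using zs(2) injD[OF inj_emb] by fastforce
    then show ?thesis
      using frame_seg_inter[OF t] frame_seg_inter[OF t(2,1)] t(3) u by auto
  qed
  have TP: "emb i d ` frame_seg TP = emb i d' ` frame_seg TP"
    "emb i d ` frame_ends TP = emb i d' ` frame_ends TP" "edge i d TP = edge i d' TP" for i d d'
  proof -
    have "fst u = 0" if "u \<in> frame_seg TP" for u
      using on_line_frame_seg[OF that] by simp
    then have "emb i d u = emb i d' u" if "u \<in> frame_seg TP" for u
      using that by (simp add: emb_def)
    then show "emb i d ` frame_seg TP = emb i d' ` frame_seg TP"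
      by simp
    show "emb i d ` frame_ends TP = emb i d' ` frame_ends TP" "edge i d TP = edge i d' TP"
      by (simp_all add: emb_def frame_ends_def edge_def)
  qed
  consider "g < g'" | "g' < g" | "g = g'" "c = c'" | "g = g'" "s = TP \<or> s' = TP"
    | "g = g'" "c \<noteq> c'" "s \<noteq> TP" "s' \<noteq> TP"
    by fastforce
  then show ?thesis
  proof cases
    case 1
    then show ?thesis using diff[OF _ s'(2) z] by blast
  next
    case 2
    then show ?thesis using diff[OF _ s(2) z(2,1)] by blast
  next
    case 3
    then show ?thesis using same[OF s(2) _ _ z(1)] s'(2) z(2) ne by blast
  next
    case 4
    then have st: "s \<noteq> s'" "s' \<in> struts g"
      using ne TP(3)[of g c c'] s'(2) by auto
    from 4(2) show ?thesis
    proof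
      assume TPs: "s = TP"
      then have "z \<in> emb g c' ` frame_seg s"
        using z(1) TP(1)[of g c c'] by simp
      from same[OF s(2) st(2,1) this] show ?thesis
        using z(2) 4(1) TPs TP(2)[of g c c'] by simp
    next
      assume TPs: "s' = TP"
      then have "z \<in> emb g c ` frame_seg s'"
        using z(2) 4(1) TP(1)[of g c c'] by simp
      from same[OF s(2) st(2,1) z(1) this] show ?thesis
        using 4(1) TPs TP(2)[of g c c'] by simp
    qed
  next
    case 5
    obtain u v where uv: "u \<in> frame_seg s" "z = emb g c u" "v \<in> frame_seg s'" "z = emb g' c' v"
      using z by blast
    have "fst u = - fst v"
      using uv(2,4) 5(1,2) by (auto simp: emb_def split: if_splits)
    then have "fst u = 0" "fst v = 0"
      using fst_frame_seg_nonneg[OF uv(1)] fst_frame_seg_nonneg[OF uv(3)] by linarith+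
    then show ?thesis
      using fst_frame_seg_zero[OF uv(1)] fst_frame_seg_zero[OF uv(3)] uv(2,4) 5(3,4) by blast
  qed
qed

lemma seg_Z:
  assumes "z \<in> closed_segment (pos N (Z i)) (pos N (Z (Suc i)))"
  shows "fst z = 8 ^ N" "real i \<le> snd z" "snd z \<le> real i + 1"
  using assms by (auto simp: in_segment algebra_simps)

lemma seg_layer_bound:
  assumes "g < N" "z \<in> emb g c ` frame_seg s"
  shows "fst z < 8 ^ N"
proof -
  obtain u where u: "u \<in> frame_seg s" "z = emb g c u"
    using assms(2) by auto
  have "fst z \<le> supn z"
    by (simp add: supn_def)
  also have "supn z \<le> 8 ^ g"
    using u supn_frame_seg_le[OF u(1)] by (simp add: supn_emb)
  also have "(8::real) ^ g < 8 ^ N"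
    using assms(1) by simp
  finally show ?thesis .
qed

lemma edges_cross:
  assumes e: "(a, b) \<in> edges N h" "(c, d) \<in> edges N h" and ne: "(a, b) \<noteq> (c, d)"
  shows "closed_segment (pos N a) (pos N b) \<inter> closed_segment (pos N c) (pos N d)
    \<subseteq> {pos N a, pos N b} \<inter> {pos N c, pos N d}"
  using e(1)
proof (cases rule: edges_cases)
  case (1 g k s)
  note g = this
  note D = edge_drawing[OF g(2,3), of N]
  from e(2) show ?thesis
  proof (cases rule: edges_cases)
    case (1 g' k' s')
    note D' = edge_drawing[OF 1(2,3), of N]
    have "edge g k s \<noteq> edge g' k' s'"
      using g(3) 1(3) ne by simp
    from edge_cross[OF g(1,2) 1(1,2) this] show ?thesis
      unfolding D D' by blast
  next
    case (2 i)
    have "z \<notin> closed_segment (pos N c) (pos N d)" if "z \<in> emb g k ` frame_seg s" for z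
      using seg_layer_bound[OF g(1) that] seg_Z(1)[of z N i] 2 by auto
    then show ?thesis
      unfolding D by blast
  qed
next
  case (2 i)
  note i = this
  from e(2) show ?thesis
  proof (cases rule: edges_cases)
    case (1 g k s)
    have "z \<notin> closed_segment (pos N a) (pos N b)" if "z \<in> emb g k ` frame_seg s" for z
      using seg_layer_bound[OF 1(1) that] seg_Z(1)[of z N i] i by auto
    then show ?thesis
      unfolding edge_drawing[OF 1(2,3), of N] by blast
  next
    case (2 j)
    show ?thesis
    proof
      fix z assume z: "z \<in> closed_segment (pos N a) (pos N b) \<inter> closed_segment (pos N c) (pos N d)"
      have "i \<noteq> j" using i 2 ne by auto
      \<comment> \<open>Two different unit segments between integer heights on one vertical line
        meet only if they are consecutive, in the shared end.\<close>
      then have "j = Suc i \<and> z = pos N (Z j) \<or> i = Suc j \<and> z = pos N (Z i)"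
        using z i 2 seg_Z[of z N i] seg_Z[of z N j] by (auto simp: prod_eq_iff)
      then show "z \<in> {pos N a, pos N b} \<inter> {pos N c, pos N d}"
        using i 2 by auto
    qed
  qed
qed

section \<open>Injectivity of the placement\<close>

fun layer :: "node \<Rightarrow> nat option" where
  "layer (P g) = Some g"
| "layer (Q g) = Some g"
| "layer (Ou g c) = Some g"
| "layer (In g c) = Some g"
| "layer (W g c) = Some g"
| "layer (Z i) = None"

text \<open>The inner bound is strict because the terminals on the inner square belong to the
  previous layer. So the position of a node determines its layer.\<close>

lemma supn_pos:
  assumes "layer x = Some g"
  shows "8 ^ g < 8 * supn (pos N x)" "supn (pos N x) \<le> 8 ^ g"
proof -
  have pair: "supn (a, b) = max \<bar>a\<bar> \<bar>b\<bar>" for a b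
    by (simp add: supn_def)
  show "8 ^ g < 8 * supn (pos N x)"
    using assms by (cases x) (auto simp: supn_emb pair)
  show "supn (pos N x) \<le> 8 ^ g"
    using assms by (cases x) (auto simp: supn_emb pair)
qed

lemma layer_pos_eq:
  assumes "layer x = Some i" "layer y = Some j" "pos N x = pos N y"
  shows "i = j"
proof -
  have False if "i < j" "layer x = Some i" "layer y = Some j" "pos N x = pos N y" for i j x y
    using supn_pos(2)[OF that(2), of N] supn_pos(1)[OF that(3), of N] that(4)
      power_increasing[of "Suc i" j "8::real"] that(1) by simp
  then show ?thesis
    using assms by (metis linorder_neqE_nat)
qed

lemma inj_on_pos: "inj_on (pos N) (nodes N h)"
proof (rule inj_onI)
  fix x y assume xy: "x \<in> nodes N h" "y \<in> nodes N h" and eq: "pos N x = pos N y"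
  have Z: False if "v \<in> nodes N h" "layer v = Some g" "pos N v = pos N (Z i)" for v g i
  proof -
    have "g < N" using that(1,2) by (auto simp: nodes_def)
    then have "supn (pos N v) < 8 ^ N"
      using supn_pos(2)[OF that(2), of N] power_strict_increasing[of g N "8::real"] by linarith
    then show False using that(3) by (simp add: supn_def)
  qed
  show "x = y"
  proof (cases "layer x")
    case None
    then obtain i where i: "x = Z i" by (cases x) auto
    with Z[OF xy(2), of _ i] eq[symmetric] have "layer y = None" by (cases "layer y") auto
    with i eq show ?thesis by (cases y) auto
  next
    case (Some g)
    then have "layer y \<noteq> None"
      using Z[OF xy(1) Some] eq by (cases y) auto
    then obtain g' where "layer y = Some g'" by auto
    with Some eq have "layer y = Some g" using layer_pos_eq by blast
    have vals: "v \<in> {P g, Q g} \<union> Ou g ` UNIV \<union> In g ` UNIV \<union> W g ` UNIV" if "layer v = Some g" for v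
      using that by (cases v) auto
    show ?thesis
      using vals[OF Some] vals[OF \<open>layer y = Some g\<close>] eq
      by (auto simp: emb_eq_iff split: if_splits)
  qed
qed

text \<open>Provides \<open>inc\<close> of \<open>planar_posetI_straight_line\<close>. For
  \<open>h = 1\<close> the only node of the chain \<open>Z\<close> would lie on no edge.\<close>

lemma nodes_Field:
  assumes "x \<in> nodes N h" "edges N h \<noteq> {}" "2 \<le> h"
  shows "x \<in> Field (edges N h)"
proof -
  have F: "fst (ends g c s) \<in> Field (edges N h)" "snd (ends g c s) \<in> Field (edges N h)"
    if "g < N" "s \<in> struts g" for g c s
    using edge_mem_edges[OF that, of c h] unfolding edge_def
    by (cases "ends g c s"; auto simp: Field_def split: if_splits)+
  have S: "OP \<in> struts g" "g = 0 \<Longrightarrow> QI \<in> struts g" "0 < g \<Longrightarrow> QW \<in> struts g" "0 < g \<Longrightarrow> WI \<in> struts g" for g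
    by (auto simp: struts_def)
  show ?thesis
  proof (cases x)
    case (P g)
    then show ?thesis using assms(1) F(2)[OF _ S(1)] by (auto simp: nodes_def)
  next
    case (Q g)
    then show ?thesis using assms(1) F(1)[OF _ S(2)] F(1)[OF _ S(3)]
      by (cases "g = 0") (auto simp: nodes_def)
  next
    case (Ou g c)
    then show ?thesis using assms(1) F(1)[OF _ S(1)] by (auto simp: nodes_def)
  next
    case (In g c)
    then show ?thesis using assms(1) F(2)[OF _ S(2)] F(2)[OF _ S(4)]
      by (cases "g = 0") (auto simp: nodes_def)
  next
    case (W g c)
    then show ?thesis using assms(1) F(2)[OF _ S(3)] by (auto simp: nodes_def)
  next
    case (Z i)
    then have "i < h" using assms(1) by (auto simp: nodes_def)
    then have "(Z i, Z (Suc i)) \<in> edges N h \<or> (Z (i - 1), Z i) \<in> edges N h"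
      using assms(3) by (cases i) (auto simp: edges_def)
    then show ?thesis using Z by (auto simp: Field_def)
  qed
qed

section \<open>Planarity, height and dimension of the layered poset\<close>

definition layered_order :: "nat \<Rightarrow> nat \<Rightarrow> (node \<times> node) set" where
  "layered_order N h = generated_order (nodes N h) (edges N h)"

context
  fixes N h :: nat
  assumes h: "N = 0 \<or> N + 1 + N div 2 \<le> h"
begin

lemma edges_level_less:
  assumes "(x, y) \<in> edges N h"
  shows "level h x < level h y"
proof (cases "N = 0")
  case True
  with assms show ?thesis by (auto simp: edges_def level_def)
next
  case False
  with assms h show ?thesis using level_edges by blast
qed

lemma partial_order_layered: "partial_order_on (nodes N h) (layered_order N h)"
  unfolding layered_order_def using edges_level_less by (rule partial_order_on_generated_order)

lemma planar_layered: "planar_poset (nodes N h) (layered_order N h)"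
proof (rule planar_posetI_straight_line)
  show "cover_relations (layered_order N h) \<subseteq> edges N h"
    unfolding layered_order_def
    using edges_level_less edges_subset by (rule cover_relations_generated_order)
  show "x \<in> Field (edges N h)" if "x \<in> nodes N h" "edges N h \<noteq> {}" for x
  proof (rule nodes_Field[OF that])
    from that(2) obtain e where "e \<in> edges N h" by auto
    \<comment> \<open>A strut needs \<open>N > 0\<close>, and then \<open>N + 1 + N div 2\<close> is
      at least 2; an edge of the chain \<open>Z\<close> gives \<open>2 \<le> h\<close>
      directly.\<close>
    then have "0 < N \<or> 2 \<le> h" by (cases rule: edges_cases) auto
    then show "2 \<le> h" using h by auto
  qed
qed (use finite_nodes partial_order_layered inj_on_pos edges_subset pos_up edges_cross in blast)+

text \<open>\<open>level\<close> bounds the height by \<open>h\<close>, and the disjoint chain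
  \<open>Z\<close> with its \<open>h\<close> elements attains it.\<close>

lemma poset_height_layered_image:
  assumes f: "inj f"
  shows "poset_height (map_prod f f ` layered_order N h) = h"
proof (rule poset_height_eqI[where rank = "level h \<circ> inv f"])
  fix x y assume "(x, y) \<in> map_prod f f ` layered_order N h" "x \<noteq> y"
  then obtain u v where uv: "x = f u" "y = f v" "(u, v) \<in> layered_order N h" "u \<noteq> v"
    by auto
  then have "level h u < level h v"
    using rank_less_rtrancl[of u v "edges N h" "level h"] edges_level_less
    by (auto simp: layered_order_def generated_order_def)
  then show "(level h \<circ> inv f) x < (level h \<circ> inv f) y"
    using uv f by simp
next
  fix x assume "x \<in> Field (map_prod f f ` layered_order N h)"
  then obtain u where "x = f u" "u \<in> nodes N h"
    by (auto simp: Field_def layered_order_def generated_order_def)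
  then show "(level h \<circ> inv f) x \<in> {0..<int h}"
    using level_range[OF h] f by simp
next
  have reach: "i \<le> j \<Longrightarrow> j < h \<Longrightarrow> (Z i, Z j) \<in> (edges N h)\<^sup>*" for i j
  proof (induction j rule: dec_induct)
    case (step j)
    have "(Z j, Z (Suc j)) \<in> edges N h"
      using step.prems by (auto simp: edges_def)
    with step show ?case by (auto intro: rtrancl_into_rtrancl)
  qed simp
  have le: "(f (Z i), f (Z j)) \<in> map_prod f f ` layered_order N h" if "i \<le> j" "j < h" for i j
  proof -
    have "(Z i, Z j) \<in> layered_order N h"
      using reach[OF that] that by (auto simp: layered_order_def generated_order_def nodes_def)
    then show ?thesis by (metis map_prod_imageI)
  qed
  show "(f \<circ> Z) ` {..<h} \<in> Chains (map_prod f f ` layered_order N h)"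
    unfolding Chains_def
  proof (intro CollectI ballI)
    fix a b assume "a \<in> (f \<circ> Z) ` {..<h}" "b \<in> (f \<circ> Z) ` {..<h}"
    then obtain i j where "a = f (Z i)" "b = f (Z j)" "i < h" "j < h"
      by auto
    then show "(a, b) \<in> map_prod f f ` layered_order N h \<or> (b, a) \<in> map_prod f f ` layered_order N h"
      using le[of i j] le[of j i] by (cases "i \<le> j") auto
  qed
  have "inj_on (f \<circ> Z) {..<h}"
    using f by (auto simp: inj_on_def)
  then show "card ((f \<circ> Z) ` {..<h}) = h"
    by (metis card_image card_lessThan)
qed

lemma poset_dim_layered_image:
  assumes f: "inj f"
  shows "2 * N \<le> poset_dim (f ` nodes N h) (map_prod f f ` layered_order N h)"
proof -
  have mem: "(f x, f y) \<in> map_prod f f ` layered_order N h \<longleftrightarrow>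
      x \<in> nodes N h \<and> y \<in> nodes N h \<and> (x, y) \<in> (edges N h)\<^sup>*" for x y
    using f by (auto simp: layered_order_def generated_order_def dest: injD)
  have "card ({..<N} \<times> (UNIV :: bool set)) \<le> poset_dim (f ` nodes N h) (map_prod f f ` layered_order N h)"
  proof (rule poset_dim_ge_standard_example[where a = "\<lambda>(g, c). f (an g c)" and b = "\<lambda>(g, c). f (bn g c)"])
    show "finite (f ` nodes N h)"
      using finite_nodes by blast
    show "partial_order_on (f ` nodes N h) (map_prod f f ` layered_order N h)"
      using partial_order_on_image[OF f partial_order_layered] .
    fix i :: "nat \<times> bool" assume i: "i \<in> {..<N} \<times> UNIV"
    then show "(case i of (g, c) \<Rightarrow> f (an g c)) \<in> f ` nodes N h" "(case i of (g, c) \<Rightarrow> f (bn g c)) \<in> f ` nodes N h"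
      using ab_nodes by auto
    show "(case i of (g, c) \<Rightarrow> f (an g c), case i of (g, c) \<Rightarrow> f (bn g c)) \<notin> map_prod f f ` layered_order N h"
      using an_not_le_bn by (cases i) (simp add: mem)
    fix j :: "nat \<times> bool" assume j: "j \<in> {..<N} \<times> UNIV" "i \<noteq> j"
    then show "(case i of (g, c) \<Rightarrow> f (an g c), case j of (g, c) \<Rightarrow> f (bn g c)) \<in> map_prod f f ` layered_order N h"
      using i ab_nodes an_le_bn
      by (cases i; cases j) (simp add: mem)
  qed
  then show ?thesis
    by (simp add: card_cartesian_product)
qed

end

theorem theorem2:
  fixes h :: nat
  assumes "h \<ge> 1"
  shows "\<exists>(A :: nat set) r. planar_poset A r \<and> poset_height r = h \<and>
           real (poset_dim A r) \<ge> (4 / 3) * real h - 2"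
proof -
  \<comment> \<open>For \<open>h \<ge> 1\<close> this is the largest \<open>N\<close> with
    \<open>N + 1 + N div 2 \<le> h\<close>.\<close>
  define N where "N = (2 * h + 2) div 3 - 1"
  have N: "N = 0 \<or> N + 1 + N div 2 \<le> h"
    using assms unfolding N_def by presburger
  \<comment> \<open>Equality holds whenever 3 divides \<open>h\<close>.\<close>
  have "4 * h \<le> 6 * N + 6"
    unfolding N_def by presburger
  then have "(4 / 3) * real h - 2 \<le> real (2 * N)"
    by linarith
  let ?f = "to_nat :: node \<Rightarrow> nat"
  have f: "inj ?f" by simp
  let ?A = "?f ` nodes N h" and ?r = "map_prod ?f ?f ` layered_order N h"
  have "real (2 * N) \<le> real (poset_dim ?A ?r)"
    using poset_dim_layered_image[OF N f] by (simp only: of_nat_le_iff)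
  then have "planar_poset ?A ?r \<and> poset_height ?r = h \<and> real (poset_dim ?A ?r) \<ge> (4 / 3) * real h - 2"
    using planar_poset_image[OF f planar_layered[OF N]] poset_height_layered_image[OF N f]
      \<open>(4 / 3) * real h - 2 \<le> real (2 * N)\<close> by linarith
  then show ?thesis by blast
qed

end
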